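(* Let $n,m\ge 1$ and consider the bilinear system of $n+m$ equations in the variables $(x_0:\dots:x_n)\in\mathbb{P}^n$, $(y_0:\dots:y_m)\in\mathbb{P}^m$: \[F_k=\sum_{i=0}^n\sum_{j=0}^m a^{(k)}_{i,j}x_iy_j=0,\qquad 1\le k\le n+m,\] with indeterminate coefficients $a^{(k)}_{i,j}$. Let $\Delta$ denote its discriminant. Let $M_x$ be the $(n+m)(n+1)\times(m+1)$ matrix whose rows are indexed by pairs $(k,i)$ with $1\le k\le n+m$, $0\le i\le n$, whose columns are indexed by $j=0,\dots,m$ (corresponding to the variables $y_0,\dots,y_m$), and whose $((k,i),j)$ entry is $a^{(k)}_{i,j}$; i.e. row $(k,i)$ is the coefficient vector of the linear form $\partial F_k/\partial x_i=\sum_j a^{(k)}_{i,j}y_j$. Then $\Delta$ lies in the ideal of the polynomial ring $\mathbb{C}[a^{(k)}_{i,j}]$ generated by the maximal (i.e. $(m+1)\times(m+1)$) minors of $M_x$. Symmetrically, $\Delta$ lies in the ideal generated by the maximal ($(n+1)\times(n+1)$) minors of the $(n+m)(m+1)\times(n+1)$ matrix $M_y$ whose row $(k,j)$ ($1\le k\le n+m$, $0\le j\le m$) is the coefficient vector $(a^{(k)}_{0,j},\dots,a^{(k)}_{n,j})$ of $\partial F_k/\partial y_j=\sum_i a^{(k)}_{i,j}x_i$.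
   Context: The discriminant of the system is the irreducible polynomial (with coprime integer coefficients, defined up to sign) in the coefficients $a^{(k)}_{i,j}$ which vanishes whenever the system has a multiple (singular) solution in $\mathbb{P}^n\times\mathbb{P}^m$ over $\mathbb{C}$, i.e. a common zero at which the $(n+m)\times(n+m)$ Jacobian matrix of $F_1,\dots,F_{n+m}$ with respect to the affine coordinates (dehomogenized variables) is singular. *)

theory Defs
  imports Complex_Main "HOL-Library.Poly_Mapping" "Jordan_Normal_Form.Determinant"
begin

text \<open>Indeterminates a^(k)_(i,j) are represented by the triple (k,i,j).
Multivariate polynomials are finitely supported maps from monomials
(finitely supported exponent vectors) to coefficients.\<close>

type_synonym var = "nat \<times> nat \<times> nat"
type_synonym 'a mpoly = "(var \<Rightarrow>\<^sub>0 nat) \<Rightarrow>\<^sub>0 'a"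

definition Var :: "var \<Rightarrow> 'a::comm_semiring_1 mpoly" where
  "Var v = Poly_Mapping.single (Poly_Mapping.single v 1) 1"

definition eval_mp :: "(var \<Rightarrow> 'a::comm_semiring_1) \<Rightarrow> 'a mpoly \<Rightarrow> 'a" where
  "eval_mp a p = (\<Sum>mon \<in> Poly_Mapping.keys p. Poly_Mapping.lookup p mon * (\<Prod>v \<in> Poly_Mapping.keys mon. a v ^ Poly_Mapping.lookup mon v))"

definition coeff_vars :: "nat \<Rightarrow> nat \<Rightarrow> var set" where
  "coeff_vars n m = {(k,i,j). 1 \<le> k \<and> k \<le> n + m \<and> i \<le> n \<and> j \<le> m}"

definition Fk :: "nat \<Rightarrow> nat \<Rightarrow> (var \<Rightarrow> complex) \<Rightarrow> nat \<Rightarrow> (nat \<Rightarrow> complex) \<Rightarrow> (nat \<Rightarrow> complex) \<Rightarrow> complex" where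
  "Fk n m A k x y = (\<Sum>i\<le>n. \<Sum>j\<le>m. A (k,i,j) * x i * y j)"

text \<open>Jacobian of the dehomogenized system (chart x_p = 1, y_q = 1) with respect to the
affine coordinates u_i = x_i/x_p (i \<noteq> p) and w_j = y_j/y_q (j \<noteq> q), evaluated at the
affine point corresponding to (x,y). Row r corresponds to the equation F_(r+1);
columns 0..n-1 to the u_i (increasing i), columns n..n+m-1 to the w_j (increasing j).\<close>
definition aff_jac :: "nat \<Rightarrow> nat \<Rightarrow> (var \<Rightarrow> complex) \<Rightarrow> (nat \<Rightarrow> complex) \<Rightarrow> (nat \<Rightarrow> complex)
    \<Rightarrow> nat \<Rightarrow> nat \<Rightarrow> complex mat" where
  "aff_jac n m A x y p q =
     (let xs = filter (\<lambda>i. i \<noteq> p) [0..<n+1]; ys = filter (\<lambda>j. j \<noteq> q) [0..<m+1] in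
      mat (n+m) (n+m) (\<lambda>(r,c). if c < n
         then (\<Sum>j\<le>m. A (r+1, xs ! c, j) * (y j / y q))
         else (\<Sum>i\<le>n. A (r+1, i, ys ! (c - n)) * (x i / x p))))"

definition singular_solution :: "nat \<Rightarrow> nat \<Rightarrow> (var \<Rightarrow> complex) \<Rightarrow> (nat \<Rightarrow> complex) \<Rightarrow> (nat \<Rightarrow> complex) \<Rightarrow> bool" where
  "singular_solution n m A x y \<longleftrightarrow>
     (\<exists>i\<le>n. x i \<noteq> 0) \<and> (\<exists>j\<le>m. y j \<noteq> 0) \<and>
     (\<forall>k\<in>{1..n+m}. Fk n m A k x y = 0) \<and>
     (\<exists>p\<le>n. \<exists>q\<le>m. x p \<noteq> 0 \<and> y q \<noteq> 0 \<and> det (aff_jac n m A x y p q) = 0)"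

definition is_discriminant :: "nat \<Rightarrow> nat \<Rightarrow> int mpoly \<Rightarrow> bool" where
  "is_discriminant n m D \<longleftrightarrow>
     (\<forall>mon\<in>Poly_Mapping.keys D. Poly_Mapping.keys mon \<subseteq> coeff_vars n m) \<and>
     irreducible D \<and>
     Gcd (Poly_Mapping.range D) = 1 \<and>
     (\<forall>A x y. singular_solution n m A x y \<longrightarrow> eval_mp A (Poly_Mapping.map of_int D) = 0)"

definition ideal_gen :: "'a::comm_ring_1 set \<Rightarrow> 'a set" where
  "ideal_gen S = {p. \<exists>F c. finite F \<and> F \<subseteq> S \<and> p = (\<Sum>s\<in>F. c s * s)}"

definition minors_x :: "nat \<Rightarrow> nat \<Rightarrow> complex mpoly set" where
  "minors_x n m = {det (mat (m+1) (m+1) (\<lambda>(r,c). Var (fst (rs!r), snd (rs!r), c))) | rs.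
      distinct rs \<and> length rs = m + 1 \<and>
      (\<forall>(k,i)\<in>set rs. 1 \<le> k \<and> k \<le> n + m \<and> i \<le> n)}"

definition minors_y :: "nat \<Rightarrow> nat \<Rightarrow> complex mpoly set" where
  "minors_y n m = {det (mat (n+1) (n+1) (\<lambda>(r,c). Var (fst (rs!r), c, snd (rs!r)))) | rs.
      distinct rs \<and> length rs = n + 1 \<and>
      (\<forall>(k,j)\<in>set rs. 1 \<le> k \<and> k \<le> n + m \<and> j \<le> m)}"

end

theory Submission
  imports Defs
begin

text \<open>If \<open>M_x\<close> has a nonzero kernel vector \<open>y\<close>, then all \<open>\<partial>F\<^sub>k/\<partial>x\<^sub>i\<close> vanish at \<open>y\<close>, so \<open>(x, y)\<close> is a singular
  solution for every \<open>x\<close>. Hence the discriminant vanishes on all matrices of deficient column rank, and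
  it remains to see that every polynomial \<open>f\<close> with this property lies in the ideal \<open>J\<close> of maximal
  minors of a matrix of indeterminates \<open>x\<^bsub>r,c\<^esub>\<close>.

  The polarizations \<open>E\<^bsub>ij\<^esub> = \<Sum>\<^sub>r x\<^bsub>r,i\<^esub> \<partial>/\<partial>x\<^bsub>r,j\<^esub>\<close> preserve both the vanishing property and \<open>J\<close>, and one may assume
  that \<open>f\<close> is homogeneous of degree \<open>w\<^sub>c\<close> in every column \<open>c < t\<close>. If \<open>w\<^sub>0 = 0\<close>, then zeroing column
  \<open>0\<close> does not change the values of \<open>f\<close>, so \<open>f = 0\<close>. Otherwise Capelli's identity shows that the operator
  \<open>\<Sum> det(x) det(\<partial>)\<close>, whose values lie in \<open>J\<close>, multiplies \<open>f\<close> by \<open>\<Prod>\<^sub>c (w\<^sub>c + c) \<noteq> 0\<close>, up to terms obtained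
  by polarization from some \<open>E\<^bsub>ka\<^esub> f\<close> with \<open>a < k\<close>. These \<open>E\<^bsub>ka\<^esub> f\<close> lie in \<open>J\<close> by induction on the weight
  \<open>\<Sum>\<^sub>c (t - c) w\<^sub>c\<close>.\<close>

abbreviation lk :: "('a \<Rightarrow>\<^sub>0 'b::zero) \<Rightarrow> 'a \<Rightarrow> 'b" where "lk \<equiv> Poly_Mapping.lookup"
abbreviation unit_mon :: "var \<Rightarrow> (var \<Rightarrow>\<^sub>0 nat)" where "unit_mon v \<equiv> Poly_Mapping.single v (Suc 0)"

section \<open>Polynomials as finitely supported maps\<close>

lemma poly_mapping_add_induct [case_names single add]:
  assumes single: "\<And>k c. P (Poly_Mapping.single k c)"
    and add: "\<And>p q. P p \<Longrightarrow> P q \<Longrightarrow> P (p + q)"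
  shows "P (p :: 'k \<Rightarrow>\<^sub>0 'b::comm_monoid_add)"
proof -
  have zero: "P 0"
    using single[of _ 0] by simp
  have "P (\<Sum>k\<in>K. Poly_Mapping.single k (lk p k))" if "finite K" for K
    using that by (induction K) (auto intro: zero single add)
  moreover have "(\<Sum>k\<in>Poly_Mapping.keys p. Poly_Mapping.single k (lk p k)) = p"
    by (rule poly_mapping_eqI)
      (auto simp: lookup_sum lookup_single when_def in_keys_iff sum.delta)
  ultimately show ?thesis
    by (metis finite_keys)
qed

lemma monomial_induct [case_names zero mult]:
  assumes zero: "P 0" and mult: "\<And>\<alpha> v. P \<alpha> \<Longrightarrow> P (\<alpha> + Poly_Mapping.single v (Suc 0))"
  shows "P (\<alpha> :: 'v \<Rightarrow>\<^sub>0 nat)"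
proof -
  have single: "P (\<beta> + Poly_Mapping.single v c)" if "P \<beta>" for v c \<beta>
  proof (induction c)
    case (Suc c)
    have "\<beta> + Poly_Mapping.single v (Suc c)
        = (\<beta> + Poly_Mapping.single v c) + Poly_Mapping.single v (Suc 0)"
      by (simp add: add.assoc flip: single_add)
    then show ?case
      using mult[OF Suc] by simp
  qed (use that in simp)
  have "P (\<beta> + \<alpha>)" if "P \<beta>" for \<beta>
    using that
    by (induction \<alpha> arbitrary: \<beta> rule: poly_mapping_add_induct)
      (auto simp: single simp flip: add.assoc)
  from this[OF zero] show ?thesis by simp
qed

lemma Var_mult_single:
  "Var v * Poly_Mapping.single \<alpha> c = Poly_Mapping.single (\<alpha> + unit_mon v) c"
  by (simp add: Var_def mult_single add.commute)

text \<open>With this rule, identities such as the product rule only have to be checked against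
  multiplication by one indeterminate.\<close>

lemma mpoly_induct [case_names const add Var]:
  fixes p :: "'a::comm_semiring_1 mpoly"
  assumes const: "\<And>c. P (Poly_Mapping.single 0 c)"
    and add: "\<And>p q. P p \<Longrightarrow> P q \<Longrightarrow> P (p + q)"
    and Var: "\<And>v p. P p \<Longrightarrow> P (Var v * p)"
  shows "P p"
proof (induction p rule: poly_mapping_add_induct)
  case (single \<alpha> c)
  show ?case
    by (induction \<alpha> rule: monomial_induct) (auto simp: const simp flip: Var_mult_single intro: Var)
qed (rule add)

lemma eval_mp_superset:
  assumes "finite K" "Poly_Mapping.keys p \<subseteq> K"
  shows "eval_mp a p = (\<Sum>\<alpha>\<in>K. lk p \<alpha> * (\<Prod>v\<in>Poly_Mapping.keys \<alpha>. a v ^ lk \<alpha> v))"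
  unfolding eval_mp_def
  by (rule sum.mono_neutral_left) (use assms in \<open>auto simp: in_keys_iff\<close>)

lemma eval_mp_add: "eval_mp a (p + q) = eval_mp a p + eval_mp a q"
proof -
  let ?K = "Poly_Mapping.keys p \<union> Poly_Mapping.keys q"
  have "Poly_Mapping.keys (p + q) \<subseteq> ?K"
    by (rule keys_add)
  then show ?thesis
    by (simp add: eval_mp_superset[of ?K] lookup_add distrib_right sum.distrib)
qed

lemma eval_mp_0 [simp]: "eval_mp a 0 = 0"
  by (simp add: eval_mp_def)

lemma eval_mp_sum: "eval_mp a (\<Sum>i\<in>I. p i) = (\<Sum>i\<in>I. eval_mp a (p i))"
  by (induction I rule: infinite_finite_induct) (auto simp: eval_mp_add)

lemma eval_mp_single:
  "eval_mp a (Poly_Mapping.single \<alpha> c) = c * (\<Prod>v\<in>Poly_Mapping.keys \<alpha>. a v ^ lk \<alpha> v)"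
  by (cases "c = 0") (auto simp: eval_mp_def)

lemma prod_keys_superset:
  assumes "finite K" "Poly_Mapping.keys \<alpha> \<subseteq> K"
  shows "(\<Prod>v\<in>Poly_Mapping.keys \<alpha>. (a v :: 'a::comm_semiring_1) ^ lk \<alpha> v) = (\<Prod>v\<in>K. a v ^ lk \<alpha> v)"
  by (rule prod.mono_neutral_left) (use assms in \<open>auto simp: in_keys_iff\<close>)

lemma eval_mp_Var_mult: "eval_mp a (Var v * p) = a v * eval_mp a p"
proof (induction p rule: poly_mapping_add_induct)
  case (single \<alpha> c)
  let ?K = "insert v (Poly_Mapping.keys \<alpha>)"
  have "(\<Prod>w\<in>Poly_Mapping.keys (\<alpha> + unit_mon v). a w ^ lk (\<alpha> + unit_mon v) w)
      = (\<Prod>w\<in>?K. a w ^ lk (\<alpha> + unit_mon v) w)"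
    by (rule prod_keys_superset) (auto dest: subsetD[OF keys_add])
  also have "\<dots> = (\<Prod>w\<in>?K. a w ^ lk \<alpha> w * (if w = v then a v else 1))"
    by (rule prod.cong) (auto simp: lookup_add lookup_single when_def power_add)
  also have "\<dots> = (\<Prod>w\<in>?K. a w ^ lk \<alpha> w) * a v"
    by (simp add: prod.distrib)
  also have "(\<Prod>w\<in>?K. a w ^ lk \<alpha> w) = (\<Prod>w\<in>Poly_Mapping.keys \<alpha>. a w ^ lk \<alpha> w)"
    by (rule prod_keys_superset[symmetric]) auto
  finally show ?case
    by (simp add: Var_mult_single eval_mp_single mult_ac)
qed (simp add: eval_mp_add distrib_left)

section \<open>Partial derivatives\<close>

text \<open>Given on coefficients, so that commutation of derivatives is a comparison of
  coefficients; the support is finite because shifting exponents by \<open>unit_mon v\<close> is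
  injective.\<close>

lift_definition mderiv :: "var \<Rightarrow> 'a::comm_semiring_1 mpoly \<Rightarrow> 'a mpoly"
  is "\<lambda>v p \<alpha>. of_nat (Suc (lk \<alpha> v)) * p (\<alpha> + unit_mon v)"
proof -
  fix v and p :: "(var \<Rightarrow>\<^sub>0 nat) \<Rightarrow> 'a"
  assume "finite {\<alpha>. p \<alpha> \<noteq> 0}"
  then have "finite ((\<lambda>\<alpha>. \<alpha> + unit_mon v) -` {\<alpha>. p \<alpha> \<noteq> 0})"
    by (rule finite_vimageI) (simp add: inj_def)
  then show "finite {\<alpha>. of_nat (Suc (lk \<alpha> v)) * p (\<alpha> + unit_mon v) \<noteq> 0}"
    by (rule rev_finite_subset) (auto simp del: of_nat_Suc)
qed

lemma mderiv_add: "mderiv v (p + q) = mderiv v p + mderiv v q"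
  by (rule poly_mapping_eqI) (simp add: mderiv.rep_eq lookup_add distrib_left del: of_nat_Suc)

lemma mderiv_0 [simp]: "mderiv v 0 = 0"
  by (rule poly_mapping_eqI) (simp add: mderiv.rep_eq)

lemma mderiv_commute: "mderiv v (mderiv w p) = mderiv w (mderiv v p)"
  by (rule poly_mapping_eqI)
    (simp add: mderiv.rep_eq lookup_add lookup_single when_def add_ac mult_ac del: of_nat_Suc)

lemma mon_add_unit_nz: "\<alpha> + unit_mon v \<noteq> 0"
  by (auto dest!: arg_cong[where f = "\<lambda>m. lk m v"] simp: lookup_add)

lemma mderiv_const [simp]: "mderiv v (Poly_Mapping.single 0 c) = 0"
  by (rule poly_mapping_eqI)
    (use mon_add_unit_nz in \<open>auto simp: mderiv.rep_eq lookup_single when_def eq_commute[of 0]\<close>)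

lemma lookup_Var_mult:
  "lk (Var v * p) (\<alpha> + unit_mon v) = lk p \<alpha>"
  by (induction p rule: poly_mapping_add_induct)
    (auto simp: Var_mult_single lookup_single when_def distrib_left lookup_add)

lemma lookup_Var_mult_0:
  assumes "lk \<alpha> v = 0"
  shows "lk (Var v * p) \<alpha> = 0"
  using assms
  by (induction p rule: poly_mapping_add_induct)
    (auto simp: Var_mult_single lookup_single when_def distrib_left lookup_add)

lemma mon_minus_unit:
  assumes "lk \<alpha> v \<noteq> 0"
  shows "\<exists>\<alpha>'. \<alpha> = \<alpha>' + unit_mon v"
  by (rule exI[of _ "\<alpha> - unit_mon v"], rule poly_mapping_eqI)
    (use assms in \<open>auto simp: lookup_add lookup_minus lookup_single when_def\<close>)

lemma mderiv_Var_mult: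
  "mderiv v (Var w * p) = (if v = w then p else 0) + Var w * mderiv v p"
proof (rule poly_mapping_eqI)
  fix \<alpha>
  show "lk (mderiv v (Var w * p)) \<alpha> = lk ((if v = w then p else 0) + Var w * mderiv v p) \<alpha>"
  proof (cases "lk \<alpha> w = 0")
    case True
    then show ?thesis
    proof (cases "v = w")
      case False
      then have "lk (\<alpha> + unit_mon v) w = 0"
        using True by (simp add: lookup_add lookup_single when_def)
      then show ?thesis
        using True False by (simp add: mderiv.rep_eq lookup_add lookup_Var_mult_0)
    qed (use True in \<open>simp add: mderiv.rep_eq lookup_add lookup_Var_mult_0 lookup_Var_mult\<close>)
  next
    case False
    then obtain \<alpha>' where \<alpha>: "\<alpha> = \<alpha>' + unit_mon w"
      using mon_minus_unit by blast
    have "lk (mderiv v (Var w * p)) \<alpha>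
        = of_nat (Suc (lk \<alpha> v)) * lk (Var w * p) ((\<alpha>' + unit_mon v) + unit_mon w)"
      by (simp add: mderiv.rep_eq \<alpha> add_ac)
    also have "\<dots> = of_nat (Suc (lk \<alpha> v)) * lk p (\<alpha>' + unit_mon v)"
      by (simp only: lookup_Var_mult)
    finally show ?thesis
      by (auto simp: \<alpha> lookup_add mderiv.rep_eq lookup_single algebra_simps lookup_Var_mult when_def)
  qed
qed

lemma mderiv_Var: "mderiv v (Var w :: 'a::comm_semiring_1 mpoly) = (if v = w then 1 else 0)"
  using mderiv_Var_mult[of v w "1::'a mpoly"] mderiv_const[of v "1::'a"] by (simp del: mderiv_const)

lemma mderiv_const_mult: "mderiv v (Poly_Mapping.single 0 c * p) = Poly_Mapping.single 0 c * mderiv v p"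
proof (induction p rule: mpoly_induct)
  case (const d)
  then show ?case by (simp add: mult_single)
next
  case (Var w p)
  have "Poly_Mapping.single 0 c * (Var w * p) = Var w * (Poly_Mapping.single 0 c * p)"
    by (rule mult.left_commute)
  then show ?case
    by (simp only: mderiv_Var_mult Var) (simp add: algebra_simps)
qed (simp add: mderiv_add distrib_left)

lemma mderiv_mult: "mderiv v (p * q) = mderiv v p * q + p * mderiv v q"
proof (induction p rule: mpoly_induct)
  case (Var w p)
  then show ?case
    by (simp only: mult.assoc[of "Var w" p q] mderiv_Var_mult) (simp add: algebra_simps)
qed (simp_all add: mderiv_const_mult mderiv_add distrib_left distrib_right add_ac)

lemma lookup_Var_mult_mderiv: "lk (Var v * mderiv v p) \<alpha> = of_nat (lk \<alpha> v) * lk p \<alpha>"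
proof (cases "lk \<alpha> v = 0")
  case False
  then obtain \<beta> where "\<alpha> = \<beta> + unit_mon v"
    using mon_minus_unit by blast
  then show ?thesis
    by (simp add: lookup_Var_mult mderiv.rep_eq lookup_add)
qed (simp add: lookup_Var_mult_0)

lemma lookup_const_mult: "lk (Poly_Mapping.single 0 c * p) \<alpha> = c * lk p \<alpha>"
  by (induction p rule: poly_mapping_add_induct)
    (auto simp: mult_single lookup_single when_def distrib_left lookup_add)

text \<open>Chain rule along the line through \<open>A\<close> in direction \<open>B\<close>. It
  converts vanishing on a family of matrices into vanishing of a combination of partial
  derivatives.\<close>

lemma eval_mp_has_deriv:
  fixes p :: "complex mpoly"
  assumes U: "finite U" "\<And>v. v \<notin> U \<Longrightarrow> B v = 0"
  shows "((\<lambda>s. eval_mp (\<lambda>u. A u + s * B u) p) has_field_derivative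
      (\<Sum>v\<in>U. B v * eval_mp A (mderiv v p))) (at 0)"
proof (induction p rule: mpoly_induct)
  case (const c)
  then show ?case by (simp add: eval_mp_single)
next
  case (add p q)
  then show ?case
    by (auto simp: eval_mp_add mderiv_add distrib_left sum.distrib intro: DERIV_add)
next
  case (Var w p)
  have "((\<lambda>s. (A w + s * B w) * eval_mp (\<lambda>u. A u + s * B u) p) has_field_derivative
      (A w + 0 * B w) * (\<Sum>v\<in>U. B v * eval_mp A (mderiv v p))
        + B w * eval_mp (\<lambda>u. A u + 0 * B u) p) (at 0)"
    by (rule DERIV_mult'[OF _ Var]) (auto intro!: derivative_eq_intros)
  moreover have "(\<Sum>v\<in>U. B v * eval_mp A (mderiv v (Var w * p)))
      = (A w + 0 * B w) * (\<Sum>v\<in>U. B v * eval_mp A (mderiv v p))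
        + B w * eval_mp (\<lambda>u. A u + 0 * B u) p"
  proof -
    have "(\<Sum>v\<in>U. B v * eval_mp A (mderiv v (Var w * p)))
      = (\<Sum>v\<in>U. (if v = w then B v * eval_mp A p else 0) + A w * (B v * eval_mp A (mderiv v p)))"
      by (rule sum.cong) (simp_all add: mderiv_Var_mult eval_mp_add eval_mp_Var_mult distrib_left mult.left_commute)
    then show ?thesis
      using U by (auto simp: sum.distrib sum_distrib_left)
  qed
  ultimately show ?case
    by (simp only: eval_mp_Var_mult)
qed

lemma eval_mp_zero_point: "eval_mp (\<lambda>_. 0) p = lk p 0"
proof (induction p rule: mpoly_induct)
  case (Var v p)
  then show ?case
    by (simp add: eval_mp_Var_mult lookup_Var_mult_0)
qed (simp_all add: eval_mp_single eval_mp_add lookup_add)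

text \<open>The constant coefficient is the value at the origin. The coefficient of
  \<open>\<alpha> + unit_mon v\<close> is, up to a nonzero integer factor, the coefficient of
  \<open>\<alpha>\<close> in \<open>mderiv v p\<close>, which again has only zero values; induction
  on the monomial reaches every coefficient.\<close>

lemma eval_mp_eq_0_imp_eq_0:
  fixes p :: "complex mpoly"
  assumes "\<And>A. eval_mp A p = 0"
  shows "p = 0"
proof -
  have "lk p \<alpha> = 0" if "\<And>A. eval_mp A p = 0" for \<alpha> and p :: "complex mpoly"
    using that
  proof (induction \<alpha> arbitrary: p rule: monomial_induct)
    case zero
    then show ?case using eval_mp_zero_point[of p] by simp
  next
    case (mult \<alpha> v)
    have "eval_mp A (mderiv v p) = 0" for A
    proof -
      have "((\<lambda>s. eval_mp (\<lambda>u. A u + s * (if u = v then 1 else 0)) p) has_field_derivative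
          (\<Sum>v'\<in>{v}. (if v' = v then 1 else 0) * eval_mp A (mderiv v' p))) (at 0)"
        by (rule eval_mp_has_deriv) auto
      then have "((\<lambda>s. 0) has_field_derivative eval_mp A (mderiv v p)) (at (0::complex))"
        using mult.prems by simp
      then show ?thesis
        using DERIV_unique DERIV_const by blast
    qed
    then have "lk (mderiv v p) \<alpha> = 0"
      by (rule mult.IH)
    then show ?case
      by (simp add: mderiv.rep_eq del: of_nat_Suc)
  qed
  with assms show ?thesis
    by (intro poly_mapping_eqI) simp
qed

section \<open>Ideals and determinants\<close>

lemma ideal_gen_base: "s \<in> S \<Longrightarrow> s \<in> ideal_gen S"
  unfolding ideal_gen_def by (auto intro!: exI[of _ "{s}"] exI[of _ "\<lambda>_. 1"])

lemma ideal_gen_0 [simp]: "0 \<in> ideal_gen S"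
  unfolding ideal_gen_def by (auto intro!: exI[of _ "{}"])

lemma ideal_gen_mult:
  assumes "p \<in> ideal_gen S"
  shows "c * p \<in> ideal_gen S"
proof -
  from assms obtain F d where "finite F" "F \<subseteq> S" "p = (\<Sum>s\<in>F. d s * s)"
    unfolding ideal_gen_def by blast
  then show ?thesis
    unfolding ideal_gen_def
    by (auto intro!: exI[of _ F] exI[of _ "\<lambda>s. c * d s"] simp: sum_distrib_left mult.assoc)
qed

lemma ideal_gen_add:
  assumes "p \<in> ideal_gen S" "q \<in> ideal_gen S"
  shows "p + q \<in> ideal_gen S"
proof -
  from assms obtain F c G d where F: "finite F" "F \<subseteq> S" "p = (\<Sum>s\<in>F. c s * s)"
    and G: "finite G" "G \<subseteq> S" "q = (\<Sum>s\<in>G. d s * s)"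
    unfolding ideal_gen_def by blast
  define e where "e s = (if s \<in> F then c s else 0) + (if s \<in> G then d s else 0)" for s
  have "p = (\<Sum>s\<in>F \<union> G. (if s \<in> F then c s else 0) * s)"
    unfolding F(3) by (rule sum.mono_neutral_cong_left) (use F G in auto)
  moreover have "q = (\<Sum>s\<in>F \<union> G. (if s \<in> G then d s else 0) * s)"
    unfolding G(3) by (rule sum.mono_neutral_cong_left) (use F G in auto)
  ultimately have "p + q = (\<Sum>s\<in>F \<union> G. e s * s)"
    by (simp add: e_def distrib_right sum.distrib)
  with F G show ?thesis
    unfolding ideal_gen_def by (intro CollectI exI[of _ "F \<union> G"] exI[of _ e]) auto
qed

lemma ideal_gen_sum: "(\<And>i. i \<in> I \<Longrightarrow> p i \<in> ideal_gen S) \<Longrightarrow> (\<Sum>i\<in>I. p i) \<in> ideal_gen S"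
  by (induction I rule: infinite_finite_induct) (auto intro: ideal_gen_add)

lemma ideal_gen_diff: "p \<in> ideal_gen S \<Longrightarrow> q \<in> ideal_gen S \<Longrightarrow> p - q \<in> ideal_gen S"
  using ideal_gen_add[of p S "- q"] ideal_gen_mult[of q S "- 1"] by simp

lemma det_mat_Leibniz:
  "det (mat n n (\<lambda>(a, c). G a c))
    = (\<Sum>p | p permutes {0..<n}. signof p * (\<Prod>a = 0..<n. G a (p a)))"
proof -
  have "(\<Prod>a = 0..<n. mat n n (\<lambda>(a, c). G a c) $$ (a, p a)) = (\<Prod>a = 0..<n. G a (p a))"
    if "p permutes {0..<n}" for p
    using permutes_in_image[OF that] by (intro prod.cong) auto
  then show ?thesis
    by (subst det_def'[of _ n]) simp_all
qed

section \<open>Polarization operators\<close>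

text \<open>\<open>ent r c\<close> is the indeterminate in row \<open>r\<close> and column \<open>c\<close>; both \<open>M_x\<close> and \<open>M_y\<close> are
  of this form, with pairs of indices as rows.\<close>

locale indet_matrix =
  fixes R :: "'r set" and ent :: "'r \<Rightarrow> nat \<Rightarrow> var"
  assumes finite_R: "finite R"
    and ent_eq_iff [simp]: "ent r c = ent r' c' \<longleftrightarrow> r = r' \<and> c = c'"
begin

definition polar :: "nat \<Rightarrow> nat \<Rightarrow> 'a::comm_ring_1 mpoly \<Rightarrow> 'a mpoly" where
  "polar i j f = (\<Sum>r\<in>R. Var (ent r i) * mderiv (ent r j) f)"

lemma polar_add: "polar i j (p + q) = polar i j p + polar i j q"
  by (simp add: polar_def mderiv_add distrib_left sum.distrib)

lemma polar_0 [simp]: "polar i j 0 = 0"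
  by (simp add: polar_def)

lemma polar_sum: "polar i j (\<Sum>x\<in>I. p x) = (\<Sum>x\<in>I. polar i j (p x))"
  by (induction I rule: infinite_finite_induct) (auto simp: polar_add)

lemma polar_mult: "polar i j (p * q) = polar i j p * q + p * polar i j q"
  by (simp add: polar_def mderiv_mult distrib_left sum.distrib sum_distrib_left sum_distrib_right mult_ac)

lemma polar_Var: "r \<in> R \<Longrightarrow> polar i j (Var (ent r c)) = (if c = j then Var (ent r i) else 0)"
  using finite_R by (simp add: polar_def mderiv_Var if_distrib[of "\<lambda>x. _ * x"] cong: if_cong)

lemma polar_const [simp]: "polar i j (Poly_Mapping.single 0 c) = 0"
  by (simp add: polar_def)

text \<open>\<open>npolar\<close> is the normally ordered product of polarizations: all derivatives act
  before all multiplications.\<close>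

fun npolar :: "(nat \<times> nat) list \<Rightarrow> 'a::comm_ring_1 mpoly \<Rightarrow> 'a mpoly" where
  "npolar [] g = g"
| "npolar ((i, j) # ps) g = (\<Sum>r\<in>R. Var (ent r i) * npolar ps (mderiv (ent r j) g))"

lemma npolar_add: "npolar ps (p + q) = npolar ps p + npolar ps q"
  by (induction ps arbitrary: p q) (auto simp: mderiv_add distrib_left sum.distrib)

lemma npolar_0 [simp]: "npolar ps 0 = 0"
  by (induction ps) auto

lemma npolar_sum: "npolar ps (\<Sum>x\<in>I. p x) = (\<Sum>x\<in>I. npolar ps (p x))"
  by (induction I rule: infinite_finite_induct) (auto simp: npolar_add)

lemma npolar_const_mult:
  "npolar ps (Poly_Mapping.single 0 c * p) = Poly_Mapping.single 0 c * npolar ps p"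
  by (induction ps arbitrary: p)
    (auto simp: mderiv_const_mult sum_distrib_left mult.left_commute)

text \<open>Polarizations need not commute, but in a normally ordered product the derivatives
  commute among themselves and so do the variables.\<close>

lemma npolar_swap: "npolar (p # q # ps) g = npolar (q # p # ps) g"
proof (cases p; cases q)
  fix i j k l assume p: "p = (i, j)" and q: "q = (k, l)"
  have "npolar (p # q # ps) g
      = (\<Sum>r\<in>R. \<Sum>s\<in>R. Var (ent r i) * (Var (ent s k) * npolar ps (mderiv (ent s l) (mderiv (ent r j) g))))"
    by (simp add: p q sum_distrib_left)
  also have "\<dots> = (\<Sum>s\<in>R. \<Sum>r\<in>R. Var (ent r i) * (Var (ent s k) * npolar ps (mderiv (ent s l) (mderiv (ent r j) g))))"
    by (rule sum.swap)
  also have "\<dots> = npolar (q # p # ps) g"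
    by (simp add: p q sum_distrib_left mult.left_commute mderiv_commute[of "ent _ l"])
  finally show ?thesis .
qed

text \<open>Product rule: the derivative in \<open>polar c a\<close> either reaches
  \<open>g\<close>, lengthening the product, or hits a variable of column \<open>a\<close> already
  multiplied in slot \<open>l\<close>, turning that target \<open>a\<close> into
  \<open>c\<close>.\<close>

lemma polar_npolar:
  "polar c a (npolar ps g) = npolar ((c, a) # ps) g
     + (\<Sum>l | l < length ps \<and> fst (ps ! l) = a. npolar (ps[l := (c, snd (ps ! l))]) g)"
proof (induction ps arbitrary: g)
  case Nil
  then show ?case by (simp add: polar_def)
next
  case (Cons p ps)
  obtain d b where p: "p = (d, b)" by (cases p)
  let ?L = "{l. l < length ps \<and> fst (ps ! l) = a}"
  have *: "{l. l < length (p # ps) \<and> fst ((p # ps) ! l) = a}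
      = (if d = a then {0} else {}) \<union> Suc ` ?L"
    by (auto simp: p less_Suc_eq_0_disj image_iff)
  have "(\<Sum>l | l < length (p # ps) \<and> fst ((p # ps) ! l) = a. npolar ((p # ps)[l := (c, snd ((p # ps) ! l))]) g)
    = (if d = a then npolar ((c, b) # ps) g else 0) + (\<Sum>l\<in>?L. npolar (p # ps[l := (c, snd (ps ! l))]) g)"
    unfolding * by (subst sum.union_disjoint) (auto simp: sum.reindex p)
  moreover have "polar c a (npolar (p # ps) g)
    = (\<Sum>r\<in>R. (if d = a then Var (ent r c) else 0) * npolar ps (mderiv (ent r b) g)
        + Var (ent r d) * polar c a (npolar ps (mderiv (ent r b) g)))"
    by (simp add: p polar_sum polar_mult polar_Var)
  moreover have "\<dots> = (if d = a then npolar ((c, b) # ps) g else 0)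
    + (\<Sum>r\<in>R. Var (ent r d) * npolar ((c, a) # ps) (mderiv (ent r b) g))
    + (\<Sum>r\<in>R. \<Sum>l\<in>?L. Var (ent r d) * npolar (ps[l := (c, snd (ps ! l))]) (mderiv (ent r b) g))"
    unfolding Cons.IH
    by (simp add: sum.distrib distrib_left sum_distrib_left del: npolar.simps) (simp add: add_ac)
  moreover have "(\<Sum>r\<in>R. Var (ent r d) * npolar ((c, a) # ps) (mderiv (ent r b) g)) = npolar ((c, a) # p # ps) g"
    by (subst npolar_swap) (simp add: p)
  moreover have "(\<Sum>r\<in>R. \<Sum>l\<in>?L. Var (ent r d) * npolar (ps[l := (c, snd (ps ! l))]) (mderiv (ent r b) g))
     = (\<Sum>l\<in>?L. npolar (p # ps[l := (c, snd (ps ! l))]) g)"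
    by (subst sum.swap) (simp add: p)
  ultimately show ?case
    by (simp only: add_ac)
qed

lemma npolar_Var_mult:
  assumes "r \<in> R" "k \<notin> snd ` set ps"
  shows "npolar ps (Var (ent r k) * g) = Var (ent r k) * npolar ps g"
  using assms(2)
proof (induction ps arbitrary: g)
  case (Cons p ps)
  obtain i j where p: "p = (i, j)" by (cases p)
  with Cons.prems have "j \<noteq> k" "k \<notin> snd ` set ps" by auto
  then show ?case
    by (simp add: p mderiv_Var_mult Cons.IH sum_distrib_left mult.left_commute)
qed simp

text \<open>With no derivative in \<open>ps\<close> acting on column \<open>k\<close>,
  multiplication by variables of that column passes through \<open>npolar ps\<close>. The factor
  \<open>(k, k)\<close> then acts on \<open>g\<close> first, where Euler's identity can evaluate
  it.\<close>

lemma npolar_polar: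
  assumes "k \<notin> snd ` set ps"
  shows "npolar ((k, k) # ps) g = npolar ps (polar k k g)"
  by (simp add: polar_def npolar_sum npolar_Var_mult assms)

lemma npolar_rotate: "npolar (ps @ p # qs) g = npolar (p # ps @ qs) g"
proof (induction ps arbitrary: g)
  case (Cons a ps)
  obtain i j where a: "a = (i, j)" by (cases a)
  have "npolar ((a # ps) @ p # qs) g = npolar (a # p # ps @ qs) g"
    by (simp add: a Cons del: npolar.simps(2)[of _ _ "p # _"])
  then show ?case
    using npolar_swap[of a p "ps @ qs" g] by simp
qed simp

text \<open>An operator whose targets contain a column \<open>k\<close> larger than all its sources
  factors, up to polarizations applied from the left, through \<open>polar k a\<close> with \<open>a < k\<close>.\<close>

lemma npolar_raising:
  assumes add: "\<And>p q. p \<in> J \<Longrightarrow> q \<in> J \<Longrightarrow> p + q \<in> J"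
    and neg: "\<And>p. p \<in> J \<Longrightarrow> - p \<in> J"
    and zero: "0 \<in> J"
    and closed: "\<And>i j p. i \<le> k \<Longrightarrow> j < k \<Longrightarrow> p \<in> J \<Longrightarrow> polar i j p \<in> J"
    and base: "\<And>a. a < k \<Longrightarrow> polar k a f \<in> J"
  assumes "\<forall>(i, j)\<in>set ps. i \<le> k \<and> j < k" "k \<in> fst ` set ps"
  shows "npolar ps f \<in> J"
  using assms(6,7)
proof (induction "length ps" arbitrary: ps)
  case (Suc n)
  have sum: "(\<Sum>x\<in>I. p x) \<in> J" if "\<And>x. x \<in> I \<Longrightarrow> p x \<in> J" for I and p :: "nat \<Rightarrow> _"
    using that by (induction I rule: infinite_finite_induct) (auto intro: zero add)
  obtain a where "(k, a) \<in> set ps" using Suc.prems by auto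
  then obtain us vs where ps: "ps = us @ (k, a) # vs" by (meson split_list)
  show ?case
  proof (cases "us @ vs")
    case Nil
    then show ?thesis
      using ps base[of a] Suc.prems by (simp add: polar_def)
  next
    case (Cons p qs)
    obtain i j where p: "p = (i, j)" by (cases p)
    have ij: "i \<le> k" "j < k" and a: "a < k"
      and all: "\<forall>(i, j)\<in>set ((k, a) # qs). i \<le> k \<and> j < k"
    proof -
      have "set ps = insert (k, a) (insert (i, j) (set qs))"
        using arg_cong[OF Cons, of set] by (auto simp: ps p)
      with Suc.prems show "i \<le> k" "j < k" "a < k" "\<forall>(i, j)\<in>set ((k, a) # qs). i \<le> k \<and> j < k"
        by auto
    qed
    let ?qs = "(k, a) # qs"
    have len: "n = length ?qs"
      using Suc.hyps(2) arg_cong[OF Cons, of length] ps by simp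
    \<comment> \<open>The factor \<open>(i, j)\<close> is traded for \<open>polar i j\<close>
      applied from the left, with \<open>(k, a)\<close> kept inside. The shorter product and its
      contractions have length \<open>n\<close> and fall under the induction hypothesis.\<close>
    have "npolar ps f = npolar ((i, j) # ?qs) f"
      using npolar_rotate[of us "(k, a)" vs f] Cons npolar_swap[of "(k, a)" "(i, j)" qs f]
      by (simp only: ps p)
    also have "\<dots> = polar i j (npolar ?qs f)
        + - (\<Sum>l | l < length ?qs \<and> fst (?qs ! l) = j. npolar (?qs[l := (i, snd (?qs ! l))]) f)"
      by (simp only: polar_npolar) simp
    also have "\<dots> \<in> J"
    proof (intro add neg closed sum ij)
      show "npolar ?qs f \<in> J"
        using len all by (intro Suc.hyps(1)) auto
      fix l assume l: "l \<in> {l. l < length ?qs \<and> fst (?qs ! l) = j}"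
      \<comment> \<open>Slot \<open>0\<close> has target \<open>k\<close>, while contractions
        concern target \<open>j < k\<close>, so the pair \<open>(k, a)\<close> survives.\<close>
      then have "l \<noteq> 0" using ij by (cases l) auto
      show "npolar (?qs[l := (i, snd (?qs ! l))]) f \<in> J"
      proof (rule Suc.hyps(1))
        show "n = length (?qs[l := (i, snd (?qs ! l))])"
          using len by (simp only: length_list_update)
        have "?qs ! l \<in> set ?qs" using l nth_mem by blast
        then have "snd (?qs ! l) < k"
          using all by (auto simp: case_prod_unfold)
        then show "\<forall>(i, j)\<in>set (?qs[l := (i, snd (?qs ! l))]). i \<le> k \<and> j < k"
          using all ij set_update_subset_insert[of ?qs l "(i, snd (?qs ! l))"] by fastforce
        show "k \<in> fst ` set (?qs[l := (i, snd (?qs ! l))])"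
          using \<open>l \<noteq> 0\<close> by (cases l) auto
      qed
    qed
    finally show ?thesis .
  qed
qed simp

section \<open>Column degrees and Euler's identity\<close>

definition col_deg :: "nat \<Rightarrow> (var \<Rightarrow>\<^sub>0 nat) \<Rightarrow> nat" where
  "col_deg c \<alpha> = (\<Sum>r\<in>R. lk \<alpha> (ent r c))"

definition col_homogeneous :: "nat \<Rightarrow> nat \<Rightarrow> 'a::zero mpoly \<Rightarrow> bool" where
  "col_homogeneous c d f \<longleftrightarrow> (\<forall>\<alpha>\<in>Poly_Mapping.keys f. col_deg c \<alpha> = d)"

lemma col_deg_add: "col_deg c (\<alpha> + \<beta>) = col_deg c \<alpha> + col_deg c \<beta>"
  by (simp add: col_deg_def lookup_add sum.distrib)

lemma col_deg_unit: "r \<in> R \<Longrightarrow> col_deg c (unit_mon (ent r i)) = (if c = i then 1 else 0)"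
  using finite_R by (auto simp: col_deg_def lookup_single when_def)

text \<open>Each monomial is an eigenvector of \<open>polar c c\<close>, with its degree in column
  \<open>c\<close> as eigenvalue.\<close>

lemma polar_euler:
  assumes "col_homogeneous c d f"
  shows "polar c c f = Poly_Mapping.single 0 (of_nat d) * f"
proof (rule poly_mapping_eqI)
  fix \<alpha>
  have "lk (polar c c f) \<alpha> = of_nat (col_deg c \<alpha>) * lk f \<alpha>"
    by (simp add: polar_def lookup_sum lookup_Var_mult_mderiv col_deg_def sum_distrib_right)
  also have "\<dots> = of_nat d * lk f \<alpha>"
    using assms by (cases "\<alpha> \<in> Poly_Mapping.keys f") (auto simp: col_homogeneous_def in_keys_iff)
  finally show "lk (polar c c f) \<alpha> = lk (Poly_Mapping.single 0 (of_nat d) * f) \<alpha>"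
    by (simp only: lookup_const_mult)
qed

text \<open>One unit of degree moves from column \<open>j\<close> to column \<open>i\<close>; the
  additive form avoids truncated subtraction and covers \<open>i = j\<close>.\<close>

lemma keys_polar:
  assumes "\<beta> \<in> Poly_Mapping.keys (polar i j f)"
  obtains \<gamma> where "\<gamma> \<in> Poly_Mapping.keys f"
    "\<And>c. col_deg c \<beta> + (if c = j then 1 else 0) = col_deg c \<gamma> + (if c = i then 1 else 0)"
proof -
  from assms obtain r where r: "r \<in> R" "lk (Var (ent r i) * mderiv (ent r j) f) \<beta> \<noteq> 0"
    unfolding polar_def in_keys_iff lookup_sum by (meson sum.neutral)
  then obtain \<alpha> where \<beta>: "\<beta> = \<alpha> + unit_mon (ent r i)"
    using mon_minus_unit lookup_Var_mult_0 by metis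
  let ?\<gamma> = "\<alpha> + unit_mon (ent r j)"
  have "?\<gamma> \<in> Poly_Mapping.keys f"
    using r unfolding \<beta> lookup_Var_mult mderiv.rep_eq in_keys_iff by auto
  moreover have "col_deg c \<beta> + (if c = j then 1 else 0) = col_deg c ?\<gamma> + (if c = i then 1 else 0)" for c
    using r(1) by (simp add: \<beta> col_deg_add col_deg_unit)
  ultimately show thesis by (rule that)
qed

section \<open>Polynomials vanishing on matrices of deficient rank\<close>

definition rank_deficient :: "nat \<Rightarrow> (var \<Rightarrow> complex) \<Rightarrow> bool" where
  "rank_deficient t A \<longleftrightarrow> (\<exists>y. (\<exists>c<t. y c \<noteq> 0) \<and> (\<forall>r\<in>R. (\<Sum>c<t. A (ent r c) * y c) = 0))"

definition vanishing :: "nat \<Rightarrow> complex mpoly \<Rightarrow> bool" where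
  "vanishing t f \<longleftrightarrow> (\<forall>A. rank_deficient t A \<longrightarrow> eval_mp A f = 0)"

text \<open>The value of \<open>polar i j f\<close> at \<open>A\<close> is the derivative of
  \<open>f\<close> in the direction that adds multiples of column \<open>i\<close> to column
  \<open>j\<close>. Such column operations preserve rank deficiency, so \<open>f\<close> is zero
  along the whole line.\<close>

lemma vanishing_polar:
  assumes f: "vanishing t f" and ij: "i \<noteq> j" "i < t" "j < t"
  shows "vanishing t (polar i j f)"
  unfolding vanishing_def
proof (intro allI impI)
  fix A assume A: "rank_deficient t A"
  then obtain y where y: "\<exists>c<t. y c \<noteq> 0" "\<And>r. r \<in> R \<Longrightarrow> (\<Sum>c<t. A (ent r c) * y c) = 0"
    unfolding rank_deficient_def by blast
  define U where "U = (\<lambda>r. ent r j) ` R"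
  define B where "B v = (\<Sum>r\<in>R. if v = ent r j then A (ent r i) else 0)" for v
  have B_ent: "B (ent r c) = (if c = j then A (ent r i) else 0)" if "r \<in> R" for r c
    using that finite_R by (auto simp: B_def)
  have "rank_deficient t (\<lambda>v. A v + s * B v)" for s
    unfolding rank_deficient_def
  proof (rule exI, intro conjI ballI)
    \<comment> \<open>Column \<open>j\<close> has gained \<open>s\<close> times column
      \<open>i\<close>; lowering coordinate \<open>i\<close> by \<open>s * y j\<close> compensates
      for this in the kernel vector.\<close>
    let ?y = "\<lambda>c. if c = i then y i - s * y j else y c"
    show "\<exists>c<t. ?y c \<noteq> 0"
    proof (cases "y j = 0")
      case True
      obtain c where "c < t" "y c \<noteq> 0" using y(1) by blast
      with True show ?thesis by (intro exI[of _ c]) auto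
    qed (use ij in auto)
    fix r assume r: "r \<in> R"
    have "(\<Sum>c<t. (A (ent r c) + s * B (ent r c)) * ?y c)
      = (\<Sum>c<t. A (ent r c) * y c - (if c = i then A (ent r i) * s * y j else 0)
           + (if c = j then s * A (ent r i) * y j else 0))"
      by (rule sum.cong) (use ij in \<open>auto simp: B_ent r algebra_simps\<close>)
    also have "\<dots> = 0"
      using ij y(2)[OF r] by (simp add: sum.distrib sum_subtractf)
    finally show "(\<Sum>c<t. (A (ent r c) + s * B (ent r c)) * ?y c) = 0" .
  qed
  then have zero: "eval_mp (\<lambda>v. A v + s * B v) f = 0" for s
    using f unfolding vanishing_def by blast
  have "((\<lambda>s. eval_mp (\<lambda>v. A v + s * B v) f) has_field_derivative
      (\<Sum>v\<in>U. B v * eval_mp A (mderiv v f))) (at 0)"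
    by (rule eval_mp_has_deriv) (auto simp: U_def B_def finite_R intro!: sum.neutral)
  then have "(\<Sum>v\<in>U. B v * eval_mp A (mderiv v f)) = 0"
    unfolding zero using DERIV_unique DERIV_const by blast
  moreover have "(\<Sum>v\<in>U. B v * eval_mp A (mderiv v f)) = eval_mp A (polar i j f)"
    unfolding U_def
    by (subst sum.reindex) (auto simp: inj_on_def B_ent polar_def eval_mp_sum eval_mp_Var_mult)
  ultimately show "eval_mp A (polar i j f) = 0" by simp
qed

section \<open>Column scaling and homogeneous components\<close>

definition scale_col :: "nat \<Rightarrow> complex \<Rightarrow> (var \<Rightarrow> complex) \<Rightarrow> var \<Rightarrow> complex" where
  "scale_col c s A v = (if v \<in> (\<lambda>r. ent r c) ` R then s * A v else A v)"

lemma eval_mp_scale_col: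
  assumes "col_homogeneous c d f"
  shows "eval_mp (scale_col c s A) f = s ^ d * eval_mp A f"
proof -
  have "(\<Prod>v\<in>Poly_Mapping.keys \<alpha>. scale_col c s A v ^ lk \<alpha> v)
      = s ^ d * (\<Prod>v\<in>Poly_Mapping.keys \<alpha>. A v ^ lk \<alpha> v)" if "\<alpha> \<in> Poly_Mapping.keys f" for \<alpha>
  proof -
    let ?E = "(\<lambda>r. ent r c) ` R"
    let ?K = "Poly_Mapping.keys \<alpha> \<union> ?E"
    have "(\<Prod>v\<in>Poly_Mapping.keys \<alpha>. scale_col c s A v ^ lk \<alpha> v) = (\<Prod>v\<in>?K. scale_col c s A v ^ lk \<alpha> v)"
      by (rule prod_keys_superset) (auto simp: finite_R)
    also have "\<dots> = (\<Prod>v\<in>?K. (if v \<in> ?E then s ^ lk \<alpha> v else 1) * A v ^ lk \<alpha> v)"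
      by (rule prod.cong) (auto simp: scale_col_def power_mult_distrib)
    also have "\<dots> = (\<Prod>v\<in>?K. if v \<in> ?E then s ^ lk \<alpha> v else 1) * (\<Prod>v\<in>?K. A v ^ lk \<alpha> v)"
      by (rule prod.distrib)
    also have "(\<Prod>v\<in>?K. A v ^ lk \<alpha> v) = (\<Prod>v\<in>Poly_Mapping.keys \<alpha>. A v ^ lk \<alpha> v)"
      by (rule prod_keys_superset[symmetric]) (auto simp: finite_R)
    also have "(\<Prod>v\<in>?K. if v \<in> ?E then s ^ lk \<alpha> v else 1) = (\<Prod>v\<in>?E. s ^ lk \<alpha> v)"
      by (rule prod.mono_neutral_cong_right) (auto simp: finite_R)
    also have "\<dots> = s ^ col_deg c \<alpha>"
      by (subst prod.reindex) (auto simp: inj_on_def col_deg_def power_sum)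
    also have "col_deg c \<alpha> = d"
      using assms that by (simp add: col_homogeneous_def)
    finally show ?thesis .
  qed
  then show ?thesis
    by (simp add: eval_mp_def sum_distrib_left mult_ac)
qed

lemma rank_deficient_scale_col:
  assumes "rank_deficient t A" "s \<noteq> 0"
  shows "rank_deficient t (scale_col c s A)"
proof -
  obtain y where y: "\<exists>c<t. y c \<noteq> 0" "\<And>r. r \<in> R \<Longrightarrow> (\<Sum>c<t. A (ent r c) * y c) = 0"
    using assms(1) unfolding rank_deficient_def by blast
  let ?y = "\<lambda>c'. if c' = c then y c / s else y c'"
  have "(\<Sum>c'<t. scale_col c s A (ent r c') * ?y c') = 0" if "r \<in> R" for r
    using that assms(2) y(2)[OF that]
    by (intro trans[OF sum.cong y(2)[OF that]]) (auto simp: scale_col_def)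
  moreover have "\<exists>c<t. ?y c \<noteq> 0"
    using y(1) assms(2) by auto
  ultimately show ?thesis
    unfolding rank_deficient_def by (intro exI[of _ ?y] conjI ballI)
qed

lemma rank_deficient_zero_col:
  assumes "c < t"
  shows "rank_deficient t (scale_col c 0 A)"
  unfolding rank_deficient_def
proof (rule exI, intro conjI ballI)
  let ?y = "\<lambda>c'. if c' = c then 1 else (0::complex)"
  show "\<exists>c<t. ?y c \<noteq> 0" using assms by auto
  fix r assume "r \<in> R"
  then show "(\<Sum>c'<t. scale_col c 0 A (ent r c') * ?y c') = 0"
    by (intro sum.neutral) (auto simp: scale_col_def)
qed

lemma vanishing_degree_0:
  assumes "vanishing t f" "c < t" "col_homogeneous c 0 f"
  shows "f = 0"
proof (rule eval_mp_eq_0_imp_eq_0)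
  fix A
  have "eval_mp (scale_col c 0 A) f = 0"
    using assms(1) rank_deficient_zero_col[OF assms(2)] by (simp add: vanishing_def)
  then show "eval_mp A f = 0"
    \<comment> \<open>In degree \<open>0\<close> the scaling factor is \<open>0 ^ 0 = 1\<close>, so
      zeroing the column leaves the value unchanged.\<close>
    by (simp add: eval_mp_scale_col[OF assms(3)])
qed

definition col_component :: "nat \<Rightarrow> nat \<Rightarrow> complex mpoly \<Rightarrow> complex mpoly" where
  "col_component c d = Poly_Mapping.mapp (\<lambda>\<alpha> x. if col_deg c \<alpha> = d then x else 0)"

lemma lookup_col_component:
  "lk (col_component c d f) \<alpha> = (if col_deg c \<alpha> = d then lk f \<alpha> else 0)"
  by (auto simp: col_component_def lookup_mapp when_def in_keys_iff)

lemma col_homogeneous_component: "col_homogeneous c d (col_component c d f)"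
  by (auto simp: col_homogeneous_def in_keys_iff lookup_col_component split: if_splits)

lemma col_homogeneous_component_other:
  "col_homogeneous c' d' f \<Longrightarrow> col_homogeneous c' d' (col_component c d f)"
  by (auto simp: col_homogeneous_def in_keys_iff lookup_col_component split: if_splits)

lemma sum_col_components:
  obtains N where "f = (\<Sum>d\<le>N. col_component c d f)"
proof
  show "f = (\<Sum>d\<le>Max (col_deg c ` Poly_Mapping.keys f). col_component c d f)"
  proof (rule poly_mapping_eqI)
    fix \<alpha>
    have "col_deg c \<alpha> \<le> Max (col_deg c ` Poly_Mapping.keys f)" if "lk f \<alpha> \<noteq> 0"
      using that by (auto simp: in_keys_iff)
    then show "lk f \<alpha> = lk (\<Sum>d\<le>Max (col_deg c ` Poly_Mapping.keys f). col_component c d f) \<alpha>"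
      by (cases "lk f \<alpha> = 0") (auto simp: lookup_sum lookup_col_component)
  qed
qed

text \<open>For a fixed deficient \<open>A\<close>, scaling column \<open>c\<close> by
  \<open>s\<close> gives a polynomial in \<open>s\<close> whose coefficients are the values of the
  components. It vanishes for all nonzero \<open>s\<close>, hence has infinitely many roots and only
  zero coefficients.\<close>

lemma vanishing_col_component:
  assumes "vanishing t f"
  shows "vanishing t (col_component c d f)"
  unfolding vanishing_def
proof (intro allI impI)
  fix A assume A: "rank_deficient t A"
  obtain N where N: "f = (\<Sum>d\<le>N. col_component c d f)"
    by (rule sum_col_components)
  have "(\<Sum>d\<le>N. eval_mp A (col_component c d f) * s ^ d) = 0" if "s \<noteq> 0" for s
  proof -
    have "eval_mp (scale_col c s A) f = 0"
      using assms rank_deficient_scale_col[OF A that] by (simp add: vanishing_def)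
    then show ?thesis
      by (subst (asm) N)
        (simp add: eval_mp_sum eval_mp_scale_col[OF col_homogeneous_component] mult.commute)
  qed
  then have "UNIV - {0} \<subseteq> {s. (\<Sum>d\<le>N. eval_mp A (col_component c d f) * s ^ d) = 0}"
    by auto
  moreover have "infinite (UNIV - {0::complex})"
    by (simp add: infinite_UNIV_char_0)
  ultimately have "infinite {s. (\<Sum>d\<le>N. eval_mp A (col_component c d f) * s ^ d) = 0}"
    using finite_subset by blast
  then have le: "eval_mp A (col_component c d f) = 0" if "d \<le> N" for d
    using that unfolding polyfun_finite_roots by blast
  show "eval_mp A (col_component c d f) = 0"
  proof (cases "d \<le> N")
    case False
    have "lk (col_component c d f) \<alpha> = 0" for \<alpha>
      using False by (subst N) (auto simp: lookup_col_component lookup_sum)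
    then have "col_component c d f = 0" by (intro poly_mapping_eqI) simp
    then show ?thesis by simp
  qed (rule le)
qed


section \<open>The Capelli argument\<close>

definition minors :: "nat \<Rightarrow> complex mpoly set" where
  "minors t = {det (mat t t (\<lambda>(a, c). Var (ent (rs ! a) c))) | rs.
      distinct rs \<and> length rs = t \<and> set rs \<subseteq> R}"

lemma polar_prod:
  assumes "finite I"
  shows "polar i j (\<Prod>a\<in>I. g a) = (\<Sum>a\<in>I. polar i j (g a) * (\<Prod>b\<in>I - {a}. g b))"
  using assms
proof (induction I)
  case empty
  then show ?case using polar_const[of i j 1] by (simp del: polar_const)
next
  case (insert x I)
  have "(\<Sum>a\<in>I. polar i j (g a) * prod g (insert x I - {a})) = (\<Sum>a\<in>I. g x * (polar i j (g a) * prod g (I - {a})))"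
  proof (rule sum.cong)
    fix a assume "a \<in> I"
    then have "insert x I - {a} = insert x (I - {a})" using insert by auto
    then show "polar i j (g a) * prod g (insert x I - {a}) = g x * (polar i j (g a) * prod g (I - {a}))"
      using insert by (simp add: mult_ac)
  qed simp
  then show ?case
    using insert by (simp add: polar_mult sum_distrib_left)
qed

text \<open>Each Leibniz term contains exactly one factor from column \<open>j\<close>, so the
  product rule leaves a single summand, in which that factor is moved to column
  \<open>i\<close>.\<close>

lemma polar_det:
  assumes "set rs \<subseteq> R" "length rs = t" "j < t"
  shows "polar i j (det (mat t t (\<lambda>(a, c). Var (ent (rs ! a) c))))
     = (det (mat t t (\<lambda>(a, c). Var (ent (rs ! a) (if c = j then i else c)))) :: complex mpoly)"
proof -
  have rs: "rs ! a \<in> R" if "a < t" for a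
    using assms that by auto
  have prod: "polar i j (\<Prod>a = 0..<t. Var (ent (rs ! a) (p a)))
      = (\<Prod>a = 0..<t. (Var (ent (rs ! a) (if p a = j then i else p a)) :: complex mpoly))"
    if p: "p permutes {0..<t}" for p
  proof -
    obtain a0 where a0: "a0 < t" "p a0 = j"
      using p assms(3) permutes_surj[OF p] permutes_in_image[OF p]
      by (metis atLeastLessThan_iff surjE zero_le)
    have uniq: "p a = j \<longleftrightarrow> a = a0" for a
      using a0 permutes_inj[OF p] by (auto dest: injD)
    have "polar i j (\<Prod>a = 0..<t. Var (ent (rs ! a) (p a)))
        = (\<Sum>a\<in>{0..<t}. polar i j (Var (ent (rs ! a) (p a)))
             * (\<Prod>b\<in>{0..<t} - {a}. Var (ent (rs ! b) (p b)) :: complex mpoly))"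
      by (rule polar_prod) simp
    also have "\<dots> = (\<Sum>a\<in>{a0}. polar i j (Var (ent (rs ! a) (p a)))
             * (\<Prod>b\<in>{0..<t} - {a}. Var (ent (rs ! b) (p b))))"
      using a0 by (intro sum.mono_neutral_right) (auto simp: polar_Var rs uniq)
    also have "\<dots> = Var (ent (rs ! a0) i) * (\<Prod>b\<in>{0..<t} - {a0}. Var (ent (rs ! b) (p b)))"
      using a0 by (simp add: polar_Var rs)
    also have "\<dots> = (\<Prod>a = 0..<t. Var (ent (rs ! a) (if p a = j then i else p a)))"
      using a0 by (subst prod.remove[of _ a0]) (auto simp: uniq intro!: prod.cong)
    finally show ?thesis .
  qed
  have sgn: "polar i j (signof p * q) = signof p * (polar i j q :: complex mpoly)" for p :: "nat \<Rightarrow> nat" and q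
  proof -
    have "polar i j (Poly_Mapping.single 0 c * q) = Poly_Mapping.single 0 c * polar i j q" for c :: complex
      by (simp add: polar_mult)
    from this[of "of_int (sign p)"] show ?thesis by simp
  qed
  show ?thesis
    by (simp add: det_mat_Leibniz polar_sum sgn prod)
qed

text \<open>By the product rule it suffices to treat the generators. A minor is reproduced if
  \<open>i = j\<close>, and otherwise becomes a determinant with two equal columns.\<close>

lemma polar_ideal:
  assumes "p \<in> ideal_gen (minors t)" "i < t" "j < t"
  shows "polar i j p \<in> ideal_gen (minors t)"
proof -
  have gen: "polar i j s \<in> ideal_gen (minors t)" if "s \<in> minors t" for s
  proof -
    from that obtain rs where rs: "s = det (mat t t (\<lambda>(a, c). Var (ent (rs ! a) c)))"
      "length rs = t" "set rs \<subseteq> R"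
      unfolding minors_def by blast
    let ?M = "mat t t (\<lambda>(a, c). Var (ent (rs ! a) (if c = j then i else c))) :: complex mpoly mat"
    have s: "polar i j s = det ?M"
      using rs assms by (simp add: polar_det)
    show ?thesis
    proof (cases "i = j")
      case True
      then have "det ?M = s" unfolding rs(1) by (intro arg_cong[of _ _ det]) auto
      then show ?thesis using s that ideal_gen_base by metis
    next
      case False
      have "det ?M = 0"
        by (rule det_identical_columns[of _ t i j]) (use assms False in \<open>auto intro!: eq_vecI\<close>)
      then show ?thesis using s by simp
    qed
  qed
  obtain F d where F: "F \<subseteq> minors t" "p = (\<Sum>s\<in>F. d s * s)"
    using assms(1) unfolding ideal_gen_def by blast
  then have "polar i j p = (\<Sum>s\<in>F. polar i j (d s) * s + d s * polar i j s)"
    by (simp add: polar_sum polar_mult)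
  also have "\<dots> \<in> ideal_gen (minors t)"
    using F(1) by (intro ideal_gen_sum ideal_gen_add ideal_gen_mult) (auto intro: gen ideal_gen_base)
  finally show ?thesis .
qed


section \<open>The Capelli operator\<close>

fun mderivs :: "('r \<times> nat) list \<Rightarrow> 'a::comm_ring_1 mpoly \<Rightarrow> 'a mpoly" where
  "mderivs [] f = f"
| "mderivs ((r, j) # xs) f = mderivs xs (mderiv (ent r j) f)"

text \<open>Choosing one row per slot separates variables from derivatives. The targets enter only
  through the variables, so a signed sum over targets acts on that factor alone.\<close>

lemma npolar_expand:
  "npolar ps f = (\<Sum>rs | set rs \<subseteq> R \<and> length rs = length ps.
     (\<Prod>l = 0..<length ps. Var (ent (rs ! l) (fst (ps ! l)))) * mderivs (zip rs (map snd ps)) f)"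
proof (induction ps arbitrary: f)
  case Nil
  have "{rs. set rs \<subseteq> R \<and> length rs = length []} = {[]}" by auto
  then show ?case by simp
next
  case (Cons p ps)
  obtain i j where p: "p = (i, j)" by (cases p)
  let ?L = "{rs. set rs \<subseteq> R \<and> length rs = length ps}"
  let ?g = "\<lambda>ps rs. (\<Prod>l = 0..<length ps. Var (ent (rs ! l) (fst (ps ! l)))) * mderivs (zip rs (map snd ps)) f"
  have "(\<Sum>rs | set rs \<subseteq> R \<and> length rs = length (p # ps). ?g (p # ps) rs)
      = (\<Sum>(rs, r)\<in>?L \<times> R. ?g (p # ps) (r # rs))"
    by (simp only: list.size(4) add_Suc_right add_0_right lists_length_Suc_eq)
      (subst sum.reindex; auto simp: inj_on_def intro!: sum.cong)
  also have "\<dots> = (\<Sum>rs\<in>?L. \<Sum>r\<in>R. ?g (p # ps) (r # rs))"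
    by (simp only: sum.cartesian_product)
  also have "\<dots> = (\<Sum>r\<in>R. \<Sum>rs\<in>?L. ?g (p # ps) (r # rs))"
    by (rule sum.swap)
  also have "\<dots> = npolar (p # ps) f"
    by (simp add: p Cons.IH sum_distrib_left prod.atLeast0_lessThan_Suc_shift mult.assoc del: prod.op_ivl_Suc)
  finally show ?case by simp
qed

text \<open>The normally ordered determinant of the matrix of polarizations among the first
  \<open>k\<close> columns. Grouping row lists by their set of rows gives the operator
  \<open>\<Sum> det(x) det(\<partial>)\<close> of Capelli's identity.\<close>

definition capelli :: "nat \<Rightarrow> complex mpoly \<Rightarrow> complex mpoly" where
  "capelli k f = (\<Sum>p | p permutes {0..<k}. signof p * npolar (map (\<lambda>l. (p l, l)) [0..<k]) f)"

lemma capelli_0: "capelli 0 f = f"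
  by (simp add: capelli_def)

text \<open>After expansion the derivatives do not depend on the permutation, so for each list of
  rows the signed sum of variables assembles into a determinant.\<close>

lemma capelli_in_ideal: "capelli t f \<in> ideal_gen (minors t)"
proof -
  let ?L = "{rs. set rs \<subseteq> R \<and> length rs = t}"
  let ?M = "\<lambda>rs. mat t t (\<lambda>(a, c). Var (ent (rs ! a) c)) :: complex mpoly mat"
  let ?D = "\<lambda>rs. mderivs (zip rs [0..<t]) f"
  have [simp]: "map (snd \<circ> (\<lambda>l. (p l, l))) [0..<t] = [0..<t]" for p :: "nat \<Rightarrow> nat"
    by (rule nth_equalityI) auto
  have "npolar (map (\<lambda>l. (p l, l)) [0..<t]) f
      = (\<Sum>rs\<in>?L. (\<Prod>l = 0..<t. Var (ent (rs ! l) (p l))) * ?D rs)" for p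
    by (simp add: npolar_expand)
  then have "capelli t f = (\<Sum>p | p permutes {0..<t}. \<Sum>rs\<in>?L.
      signof p * (\<Prod>l = 0..<t. Var (ent (rs ! l) (p l))) * ?D rs)"
    by (simp add: capelli_def sum_distrib_left mult.assoc)
  also have "\<dots> = (\<Sum>rs\<in>?L. \<Sum>p | p permutes {0..<t}.
      signof p * (\<Prod>l = 0..<t. Var (ent (rs ! l) (p l))) * ?D rs)"
    by (rule sum.swap)
  also have "\<dots> = (\<Sum>rs\<in>?L. ?D rs * det (?M rs))"
    by (simp add: det_mat_Leibniz sum_distrib_left mult.commute)
  also have "\<dots> \<in> ideal_gen (minors t)"
  proof (intro ideal_gen_sum ideal_gen_mult)
    fix rs assume rs: "rs \<in> ?L"
    show "det (?M rs) \<in> ideal_gen (minors t)"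
    \<comment> \<open>Only lists without repetition give generators; a repeated row makes the
      determinant zero.\<close>
    proof (cases "distinct rs")
      case True
      then show ?thesis
        using rs by (intro ideal_gen_base) (auto simp: minors_def)
    next
      case False
      then obtain a b where "a < t" "b < t" "a \<noteq> b" "rs ! a = rs ! b"
        using rs by (auto simp: distinct_conv_nth)
      then have "det (?M rs) = 0"
        by (intro det_identical_rows[of _ t a b]) (auto intro!: eq_vecI)
      then show ?thesis by simp
    qed
  qed
  finally show ?thesis .
qed

text \<open>Capelli's recursion: the shift by \<open>k\<close> collects the contractions produced when the
  polarization out of column \<open>k\<close> is moved in front of the normally ordered product.\<close>

lemma capelli_Suc:
  assumes t: "k < t"
    and hom: "col_homogeneous k d f"
    and base: "\<And>a. a < k \<Longrightarrow> polar k a f \<in> ideal_gen (minors t)"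
  shows "capelli (Suc k) f - Poly_Mapping.single 0 (of_nat (d + k)) * capelli k f
    \<in> ideal_gen (minors t)"
proof -
  define S where "S p m = npolar (map (\<lambda>l. (p l, l)) [0..<m]) f" for p m
  have capelli_S: "capelli m f = (\<Sum>p | p permutes {0..<m}. signof p * S p m)" for m
    by (simp add: capelli_def S_def)
  let ?J = "ideal_gen (minors t)"
  let ?P = "{q. q permutes {0..<k}}"
  have neg: "- p \<in> ?J" if "p \<in> ?J" for p
    using ideal_gen_mult[OF that, of "- 1"] by simp
  have Suc: "S p (Suc k) = npolar ((p k, k) # map (\<lambda>l. (p l, l)) [0..<k]) f" for p
    using npolar_rotate[of "map (\<lambda>l. (p l, l)) [0..<k]" "(p k, k)" "[]" f]
    by (simp add: S_def del: npolar.simps)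
  \<comment> \<open>Permutations fixing \<open>k\<close>: the factor \<open>(k, k)\<close> acts
    first and contributes the degree \<open>d\<close>.\<close>
  have diag: "S q (Suc k) = of_nat d * S q k" if q: "q \<in> ?P" for q
  proof -
    have qk: "q k = k"
      using q permutes_not_in[of q "{0..<k}" k] by simp
    have "S q (Suc k) = npolar (map (\<lambda>l. (q l, l)) [0..<k]) (polar k k f)"
      unfolding Suc qk by (rule npolar_polar) auto
    also have "\<dots> = Poly_Mapping.single 0 (of_nat d) * S q k"
      by (simp only: polar_euler[OF hom] npolar_const_mult S_def)
    finally show ?thesis by simp
  qed
  \<comment> \<open>Permutations with value \<open>b < k\<close> at \<open>k\<close>: the leading
    factor \<open>(b, k)\<close> is replaced by \<open>polar b k\<close> applied from the left, and
    the only contraction restores the product for \<open>q\<close>.\<close>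
  have off: "S (transpose k b \<circ> q) (Suc k) + S q k \<in> ?J" if q: "q \<in> ?P" and b: "b < k" for q b
  proof -
    let ?p = "transpose k b \<circ> q"
    let ?ps = "map (\<lambda>l. (?p l, l)) [0..<k]"
    let ?qs = "map (\<lambda>l. (q l, l)) [0..<k]"
    have qk: "q k = k"
      using q permutes_not_in[of q "{0..<k}" k] by simp
    obtain l0 where l0: "l0 < k" "q l0 = b"
      using q b permutes_surj[of q "{0..<k}"] permutes_in_image[of q "{0..<k}"]
      by (metis atLeastLessThan_iff mem_Collect_eq surjE zero_le)
    have uniq: "q l = b \<longleftrightarrow> l = l0" for l
      using l0 q permutes_inj[of q] by (auto dest: injD)
    have lt: "q l < k" if "l < k" for l
      using that q permutes_in_image[of q "{0..<k}" l] by simp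
    have p: "?p l = (if l = l0 then k else q l)" if "l < k" for l
      using lt[OF that] uniq by (auto simp: transpose_def)
    have "?p l = k \<longleftrightarrow> l = l0" if "l < k" for l
      using p[OF that] lt[OF that] by simp
    then have "{l. l < length ?ps \<and> fst (?ps ! l) = k} = {l0}"
      using l0(1) by (auto simp del: o_apply)
    moreover have "?ps[l0 := (b, snd (?ps ! l0))] = ?qs"
      by (rule nth_equalityI) (use l0 p in \<open>auto simp: nth_list_update\<close>)
    ultimately have "polar b k (npolar ?ps f) = npolar ((b, k) # ?ps) f + npolar ?qs f"
      by (simp add: polar_npolar del: npolar.simps)
    moreover have "S ?p (Suc k) = npolar ((b, k) # ?ps) f"
      using Suc[of ?p] by (simp only: o_apply qk transpose_apply_first)
    ultimately have "S ?p (Suc k) + S q k = polar b k (npolar ?ps f)"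
      by (simp only: S_def[of q])
    \<comment> \<open>All sources in \<open>?ps\<close> are below \<open>k\<close>, while slot
      \<open>l0\<close> has target \<open>k\<close>, so this is a raising product.\<close>
    also have "npolar ?ps f \<in> ?J"
    proof (rule npolar_raising[where k = k])
      show "\<forall>(i, j)\<in>set ?ps. i \<le> k \<and> j < k"
        using p lt by (auto simp: less_imp_le)
      have "(k, l0) \<in> set ?ps"
        using p[OF l0(1)] l0(1) by force
      then show "k \<in> fst ` set ?ps" by force
    qed (use t base in \<open>auto intro: ideal_gen_add neg polar_ideal\<close>)
    then have "polar b k (npolar ?ps f) \<in> ?J"
      using t b by (intro polar_ideal) auto
    finally show ?thesis .
  qed
  \<comment> \<open>The transposition flips the sign, so the terms congruent to
    \<open>- S q k\<close> count positively; over the \<open>k\<close> choices of \<open>b\<close>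
    they sum to \<open>k\<close> times \<open>capelli k f\<close>.\<close>
  have sgn: "signof (transpose k b \<circ> q) = - (signof q :: complex mpoly)" if "q \<in> ?P" "b < k" for q b
  proof -
    have "permutation q"
      using that permutation_permutes by blast
    then show ?thesis
      using that by (simp add: sign_compose permutation_swap_id sign_swap_id)
  qed
  have "capelli (Suc k) f = (\<Sum>p | p permutes insert k {0..<k}. signof p * S p (Suc k))"
    by (simp add: capelli_S atLeast0_lessThan_Suc)
  \<comment> \<open>Permutations are sorted by their value \<open>b\<close> at \<open>k\<close>;
    \<open>b = k\<close> gives the diagonal terms.\<close>
  also have "\<dots> = (\<Sum>b\<in>insert k {0..<k}. \<Sum>q\<in>?P. signof (transpose k b \<circ> q) * S (transpose k b \<circ> q) (Suc k))"
    by (rule sum_over_permutations_insert) auto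
  also have "\<dots> = (\<Sum>q\<in>?P. signof q * S q (Suc k))
      + (\<Sum>b\<in>{0..<k}. \<Sum>q\<in>?P. signof (transpose k b \<circ> q) * S (transpose k b \<circ> q) (Suc k))"
    by simp
  also have "(\<Sum>q\<in>?P. signof q * S q (Suc k)) = of_nat d * capelli k f"
    by (simp add: diag capelli_S sum_distrib_left mult_ac)
  also have "(\<Sum>b\<in>{0..<k}. \<Sum>q\<in>?P. signof (transpose k b \<circ> q) * S (transpose k b \<circ> q) (Suc k))
      = (\<Sum>b\<in>{0..<k}. \<Sum>q\<in>?P. signof q * S q k - signof q * (S (transpose k b \<circ> q) (Suc k) + S q k))"
    by (intro sum.cong refl) (simp add: sgn algebra_simps)
  also have "\<dots> = of_nat k * capelli k f
      - (\<Sum>b\<in>{0..<k}. \<Sum>q\<in>?P. signof q * (S (transpose k b \<circ> q) (Suc k) + S q k))"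
    by (simp add: sum_subtractf capelli_S)
  finally have "capelli (Suc k) f - (of_nat d + of_nat k) * capelli k f
      = - (\<Sum>b\<in>{0..<k}. \<Sum>q\<in>?P. signof q * (S (transpose k b \<circ> q) (Suc k) + S q k))"
    by (simp only: distrib_right) simp
  moreover have "of_nat d + of_nat k = (Poly_Mapping.single 0 (of_nat (d + k)) :: complex mpoly)"
    by (metis single_of_nat of_nat_add)
  ultimately have "capelli (Suc k) f - Poly_Mapping.single 0 (of_nat (d + k)) * capelli k f
      = - (\<Sum>b\<in>{0..<k}. \<Sum>q\<in>?P. signof q * (S (transpose k b \<circ> q) (Suc k) + S q k))"
    by (simp only:)
  also have "\<dots> \<in> ?J"
    by (intro neg ideal_gen_sum ideal_gen_mult off) auto
  finally show ?thesis .
qed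

text \<open>Iterates the recursion: modulo the ideal, passing from \<open>k\<close> to
  \<open>Suc k\<close> multiplies by \<open>w k + k\<close>.\<close>

lemma capelli_cong_ideal:
  assumes "k \<le> t"
    and hom: "\<And>c. c < t \<Longrightarrow> col_homogeneous c (w c) f"
    and base: "\<And>k a. a < k \<Longrightarrow> k < t \<Longrightarrow> polar k a f \<in> ideal_gen (minors t)"
  shows "capelli k f - Poly_Mapping.single 0 (of_nat (\<Prod>c<k. w c + c)) * f \<in> ideal_gen (minors t)"
  using assms(1)
proof (induction k)
  case 0
  then show ?case by (simp add: capelli_0)
next
  case (Suc k)
  let ?n = "\<lambda>x. Poly_Mapping.single 0 (of_nat x) :: complex mpoly"
  let ?a = "?n (w k + k)" and ?b = "?n (\<Prod>c<k. w c + c)"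
  have "capelli (Suc k) f - ?n (\<Prod>c<Suc k. w c + c) * f
      = (capelli (Suc k) f - ?a * capelli k f) + ?a * (capelli k f - ?b * f)"
  proof -
    have "?n (\<Prod>c<Suc k. w c + c) = ?a * ?b"
      by (simp add: mult_single mult.commute del: of_nat_prod single_of_nat of_nat_add)
    then show ?thesis
      by (simp only: right_diff_distrib mult.assoc) simp
  qed
  also have "\<dots> \<in> ideal_gen (minors t)"
    using Suc by (intro ideal_gen_add ideal_gen_mult capelli_Suc hom base) auto
  finally show ?case .
qed

lemma vanishing_homogeneous_in_ideal:
  assumes "0 < t" "vanishing t f"
    and "\<forall>c<t. \<exists>d. col_homogeneous c d f"
    and "\<forall>\<alpha>\<in>Poly_Mapping.keys f. (\<Sum>c<t. (t - c) * col_deg c \<alpha>) < N"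
  shows "f \<in> ideal_gen (minors t)"
  using assms(2-)
proof (induction N arbitrary: f)
  case 0
  then have "f = 0"
    by (intro poly_mapping_eqI) (auto simp: in_keys_iff)
  then show ?case by simp
next
  case (Suc N)
  obtain w where w: "\<And>c. c < t \<Longrightarrow> col_homogeneous c (w c) f"
    using Suc.prems(2) by metis
  show ?case
  proof (cases "w 0 = 0")
    case True
    then have "f = 0"
      using vanishing_degree_0[of t f 0] Suc.prems(1) w[of 0] assms(1) by simp
    then show ?thesis by simp
  next
    case False
    have base: "polar k a f \<in> ideal_gen (minors t)" if ak: "a < k" "k < t" for k a
    proof (rule Suc.IH)
      show "vanishing t (polar k a f)"
        using ak Suc.prems(1) by (intro vanishing_polar) auto
      have "col_homogeneous c (w c + (if c = k then 1 else 0) - (if c = a then 1 else 0)) (polar k a f)"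
        if "c < t" for c
        unfolding col_homogeneous_def
      proof
        fix \<beta> assume "\<beta> \<in> Poly_Mapping.keys (polar k a f)"
        then obtain \<gamma> where "\<gamma> \<in> Poly_Mapping.keys f"
          "\<And>c. col_deg c \<beta> + (if c = a then 1 else 0) = col_deg c \<gamma> + (if c = k then 1 else 0)"
          by (rule keys_polar) blast
        then show "col_deg c \<beta> = w c + (if c = k then 1 else 0) - (if c = a then 1 else 0)"
          using w[OF that] unfolding col_homogeneous_def by (metis add_diff_cancel_right')
      qed
      then show "\<forall>c<t. \<exists>d. col_homogeneous c d (polar k a f)" by blast
      show "\<forall>\<beta>\<in>Poly_Mapping.keys (polar k a f). (\<Sum>c<t. (t - c) * col_deg c \<beta>) < N"
      proof
        fix \<beta> assume "\<beta> \<in> Poly_Mapping.keys (polar k a f)"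
        then obtain \<gamma> where \<gamma>: "\<gamma> \<in> Poly_Mapping.keys f"
          "\<And>c. col_deg c \<beta> + (if c = a then 1 else 0) = col_deg c \<gamma> + (if c = k then 1 else 0)"
          by (rule keys_polar) blast
        \<comment> \<open>Moving one unit of degree from column \<open>a\<close> to column
          \<open>k\<close> exchanges a weight \<open>t - a\<close> for \<open>t - k\<close>, a
          strict drop because \<open>a < k < t\<close>.\<close>
        have "(\<Sum>c<t. (t - c) * (col_deg c \<beta> + (if c = a then 1 else 0)))
            = (\<Sum>c<t. (t - c) * (col_deg c \<gamma> + (if c = k then 1 else 0)))"
          by (simp only: \<gamma>(2))
        then have "(\<Sum>c<t. (t - c) * col_deg c \<beta>) + (t - a) = (\<Sum>c<t. (t - c) * col_deg c \<gamma>) + (t - k)"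
          using ak by (simp add: distrib_left sum.distrib if_distrib[of "\<lambda>x. _ * x"] cong: if_cong)
        moreover have "(\<Sum>c<t. (t - c) * col_deg c \<gamma>) < Suc N"
          using Suc.prems(3) \<gamma>(1) by blast
        ultimately show "(\<Sum>c<t. (t - c) * col_deg c \<beta>) < N"
          using ak by linarith
      qed
    qed
    let ?n = "\<Prod>c<t. w c + c"
    have "capelli t f - Poly_Mapping.single 0 (of_nat ?n) * f \<in> ideal_gen (minors t)"
      using w base by (intro capelli_cong_ideal) auto
    from ideal_gen_diff[OF capelli_in_ideal[of t f] this]
    have *: "Poly_Mapping.single 0 (of_nat ?n) * f \<in> ideal_gen (minors t)"
      by (simp del: single_of_nat)
    \<comment> \<open>The factor for \<open>c > 0\<close> is at least \<open>c\<close>, and the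
      factor for \<open>c = 0\<close> is \<open>w 0\<close>, nonzero in this case.\<close>
    have "?n \<noteq> 0"
      using False by (simp add: prod_zero_iff)
    then have inv: "Poly_Mapping.single 0 (inverse (of_nat ?n)) * (Poly_Mapping.single 0 (of_nat ?n) * f) = f"
      by (simp add: mult.assoc[symmetric] mult_single del: single_of_nat of_nat_prod)
    show ?thesis
      using ideal_gen_mult[OF *, of "Poly_Mapping.single 0 (inverse (of_nat ?n))"] unfolding inv .
  qed
qed

text \<open>Columns are split into homogeneous components one at a time, which keeps the homogeneity
  already reached in earlier columns. The induction descends from \<open>k = t\<close>, the
  homogeneous case, to \<open>k = 0\<close>, where no homogeneity is assumed.\<close>

lemma vanishing_in_ideal:
  assumes "0 < t" "vanishing t f"
  shows "f \<in> ideal_gen (minors t)"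
proof -
  have "f \<in> ideal_gen (minors t)" if "k \<le> t" "vanishing t f" "\<forall>c<k. \<exists>d. col_homogeneous c d f" for k f
    using that
  proof (induction k arbitrary: f rule: inc_induct)
    case base
    let ?\<mu> = "\<lambda>\<alpha>. \<Sum>c<t. (t - c) * col_deg c \<alpha>"
    have "\<forall>\<alpha>\<in>Poly_Mapping.keys f. ?\<mu> \<alpha> < Suc (Max (?\<mu> ` Poly_Mapping.keys f))"
      by (simp add: less_Suc_eq_le)
    with base assms(1) show ?case
      by (intro vanishing_homogeneous_in_ideal) auto
  next
    case (step k)
    obtain M where M: "f = (\<Sum>d\<le>M. col_component k d f)"
      by (rule sum_col_components)
    have "\<exists>e. col_homogeneous c e (col_component k d f)" if "c < Suc k" for c d
      using that step.prems(2) col_homogeneous_component[of k d f]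
        col_homogeneous_component_other[of c _ f k d]
      by (metis less_Suc_eq)
    then have "col_component k d f \<in> ideal_gen (minors t)" for d
      using step.prems by (intro step.IH vanishing_col_component) auto
    then show ?case
      by (subst M) (rule ideal_gen_sum)
  qed
  from this[of 0] assms show ?thesis by simp
qed

end

section \<open>The discriminant\<close>

lemma det_zero_col:
  assumes "A \<in> carrier_mat n n" "c < n" "\<And>r. r < n \<Longrightarrow> A $$ (r, c) = 0"
  shows "det A = 0"
  using assms by (subst laplace_expansion_column[of A n c]) auto

lemma filter_upt_nonzero: "filter (\<lambda>i. i \<noteq> 0) [0..<n + 1] = [1..<n + 1]"
  by (simp add: upt_conv_Cons)

text \<open>The vector \<open>y\<close> annihilates every partial derivative by an \<open>x\<close>
  variable, which makes all equations hold and the \<open>x\<close> columns of the Jacobian zero.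
  The point \<open>(1 : 0 : ... : 0)\<close> allows the chart \<open>p = 0\<close>.\<close>

lemma singular_solution_x:
  assumes "n \<ge> 1" and y: "\<exists>j\<le>m. y j \<noteq> 0"
    and ker: "\<And>k i. 1 \<le> k \<Longrightarrow> k \<le> n + m \<Longrightarrow> i \<le> n \<Longrightarrow> (\<Sum>j\<le>m. A (k, i, j) * y j) = 0"
  shows "singular_solution n m A (\<lambda>i. if i = 0 then 1 else 0) y"
proof -
  let ?x = "\<lambda>i::nat. if i = 0 then 1 else (0::complex)"
  obtain q where q: "q \<le> m" "y q \<noteq> 0" using y by blast
  have "Fk n m A k ?x y = 0" if "k \<in> {1..n + m}" for k
  proof -
    have "Fk n m A k ?x y = (\<Sum>i\<le>n. ?x i * (\<Sum>j\<le>m. A (k, i, j) * y j))"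
      unfolding Fk_def by (intro sum.cong refl) (simp add: sum_distrib_left mult_ac)
    also have "\<dots> = 0"
      using that by (intro sum.neutral) (simp add: ker)
    finally show ?thesis .
  qed
  moreover have "det (aff_jac n m A ?x y 0 q) = 0"
  \<comment> \<open>Column \<open>0\<close> belongs to the coordinate of index \<open>1\<close>,
    since index \<open>0\<close> is the one filtered out; \<open>n \<ge> 1\<close> makes it an
    \<open>x\<close> column.\<close>
  proof (rule det_zero_col[where c = 0])
    fix r assume r: "r < n + m"
    have "(\<Sum>j\<le>m. A (r + 1, 1, j) * (y j / y q)) = (\<Sum>j\<le>m. A (r + 1, 1, j) * y j) / y q"
      by (simp add: sum_divide_distrib)
    then show "aff_jac n m A ?x y 0 q $$ (r, 0) = 0"
      using r assms(1) ker[of "r + 1" 1] unfolding aff_jac_def Let_def filter_upt_nonzero by (simp del: upt_Suc)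
  qed (use assms(1) in \<open>auto simp: aff_jac_def Let_def\<close>)
  moreover have "\<exists>i\<le>n. ?x i \<noteq> 0"
    by (rule exI[of _ 0]) simp
  moreover have "0 \<le> n" "?x 0 \<noteq> 0" by simp_all
  ultimately show ?thesis
    using y q unfolding singular_solution_def by blast
qed

lemma singular_solution_y:
  assumes "m \<ge> 1" and x: "\<exists>i\<le>n. x i \<noteq> 0"
    and ker: "\<And>k j. 1 \<le> k \<Longrightarrow> k \<le> n + m \<Longrightarrow> j \<le> m \<Longrightarrow> (\<Sum>i\<le>n. A (k, i, j) * x i) = 0"
  shows "singular_solution n m A x (\<lambda>j. if j = 0 then 1 else 0)"
proof -
  let ?y = "\<lambda>j::nat. if j = 0 then 1 else (0::complex)"
  obtain p where p: "p \<le> n" "x p \<noteq> 0" using x by blast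
  have "Fk n m A k x ?y = 0" if "k \<in> {1..n + m}" for k
  proof -
    have "Fk n m A k x ?y = (\<Sum>j\<le>m. ?y j * (\<Sum>i\<le>n. A (k, i, j) * x i))"
      unfolding Fk_def by (subst sum.swap) (intro sum.cong refl, simp add: sum_distrib_left mult_ac)
    also have "\<dots> = 0"
      using that by (intro sum.neutral) (simp add: ker)
    finally show ?thesis .
  qed
  moreover have "det (aff_jac n m A x ?y p 0) = 0"
  \<comment> \<open>Column \<open>n\<close> is the first \<open>y\<close> column, again for index
    \<open>1\<close>; it exists because \<open>m \<ge> 1\<close>.\<close>
  proof (rule det_zero_col[where c = n])
    fix r assume r: "r < n + m"
    have "(\<Sum>i\<le>n. A (r + 1, i, 1) * (x i / x p)) = (\<Sum>i\<le>n. A (r + 1, i, 1) * x i) / x p"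
      by (simp add: sum_divide_distrib)
    then show "aff_jac n m A x ?y p 0 $$ (r, n) = 0"
      using r assms(1) ker[of "r + 1" 1] unfolding aff_jac_def Let_def filter_upt_nonzero by (simp del: upt_Suc)
  qed (use assms(1) in \<open>auto simp: aff_jac_def Let_def\<close>)
  moreover have "\<exists>j\<le>m. ?y j \<noteq> 0"
    by (rule exI[of _ 0]) simp
  moreover have "0 \<le> m" "?y 0 \<noteq> 0" by simp_all
  ultimately show ?thesis
    using x p unfolding singular_solution_def by blast
qed

theorem theorem1:
  fixes n m :: nat and D :: "int mpoly"
  assumes "n \<ge> 1" and "m \<ge> 1" and "is_discriminant n m D"
  shows "(Poly_Mapping.map of_int D :: complex mpoly) \<in> ideal_gen (minors_x n m)
       \<and> (Poly_Mapping.map of_int D :: complex mpoly) \<in> ideal_gen (minors_y n m)"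
proof
  let ?D = "Poly_Mapping.map of_int D :: complex mpoly"
  have D: "eval_mp A ?D = 0" if "singular_solution n m A x y" for A x y
    using assms(3) that unfolding is_discriminant_def by blast
  have fin: "finite {(k::nat, i::nat). 1 \<le> k \<and> k \<le> n + m \<and> i \<le> l}" for l
    by (rule finite_subset[of _ "{..n + m} \<times> {..l}"]) auto
  show "?D \<in> ideal_gen (minors_x n m)"
  proof -
    let ?R = "{(k::nat, i::nat). 1 \<le> k \<and> k \<le> n + m \<and> i \<le> n}"
    \<comment> \<open>The rows of \<open>M_x\<close> are the pairs \<open>(k, i)\<close>; the column
      index fills the last slot of the triple.\<close>
    interpret indet_matrix ?R "\<lambda>p c. (fst p, snd p, c)"
      by unfold_locales (use fin in \<open>auto simp: prod_eq_iff\<close>)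
    have "vanishing (m + 1) ?D"
      unfolding vanishing_def
    proof (intro allI impI)
      fix A assume "rank_deficient (m + 1) A"
      then obtain y where "\<exists>j\<le>m. y j \<noteq> 0"
        "\<And>k i. 1 \<le> k \<Longrightarrow> k \<le> n + m \<Longrightarrow> i \<le> n \<Longrightarrow> (\<Sum>j\<le>m. A (k, i, j) * y j) = 0"
        unfolding rank_deficient_def by (auto simp: less_Suc_eq_le lessThan_Suc_atMost)
      with assms(1) have "singular_solution n m A (\<lambda>i. if i = 0 then 1 else 0) y"
        by (intro singular_solution_x)
      then show "eval_mp A ?D = 0"
        by (rule D)
    qed
    then have "?D \<in> ideal_gen (minors (m + 1))"
      by (intro vanishing_in_ideal) simp
    moreover have "minors (m + 1) = minors_x n m"
      unfolding minors_def minors_x_def by (simp add: subset_iff Ball_def)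
    ultimately show ?thesis by simp
  qed
  show "?D \<in> ideal_gen (minors_y n m)"
  proof -
    let ?R = "{(k::nat, j::nat). 1 \<le> k \<and> k \<le> n + m \<and> j \<le> m}"
    \<comment> \<open>For \<open>M_y\<close> the rows are the pairs \<open>(k, j)\<close>, and the
      column index fills the middle slot.\<close>
    interpret indet_matrix ?R "\<lambda>p c. (fst p, c, snd p)"
      by unfold_locales (use fin in \<open>auto simp: prod_eq_iff\<close>)
    have "vanishing (n + 1) ?D"
      unfolding vanishing_def
    proof (intro allI impI)
      fix A assume "rank_deficient (n + 1) A"
      then obtain x where "\<exists>i\<le>n. x i \<noteq> 0"
        "\<And>k j. 1 \<le> k \<Longrightarrow> k \<le> n + m \<Longrightarrow> j \<le> m \<Longrightarrow> (\<Sum>i\<le>n. A (k, i, j) * x i) = 0"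
        unfolding rank_deficient_def by (auto simp: less_Suc_eq_le lessThan_Suc_atMost)
      with assms(2) have "singular_solution n m A x (\<lambda>j. if j = 0 then 1 else 0)"
        by (intro singular_solution_y)
      then show "eval_mp A ?D = 0"
        by (rule D)
    qed
    then have "?D \<in> ideal_gen (minors (n + 1))"
      by (intro vanishing_in_ideal) simp
    moreover have "minors (n + 1) = minors_y n m"
      unfolding minors_def minors_y_def by (simp add: subset_iff Ball_def)
    ultimately show ?thesis by simp
  qed
qed

end
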